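(* Let $G$ be a connected threshold graph with vertices $1,\dots,n$ (in the order of its construction as a threshold graph), and let $k+1$ be the number of distinct eigenvalues of its Laplacian. Then for every $1\le t\le k-1$, the singleton $\{n\}$ is a uniformly weighted design of $G$ of strength $t$. In other words, for every $1\le t\le k-1$ the eigenconfiguration $\mathcal{B}_t$ of $G$ is $2$-valued.
   Context: A threshold graph is a graph with vertices $1,\dots,n$ such that each vertex $i$ is either connected to all vertices before it (a dominating vertex) or to none of the vertices before it (an isolated vertex). The Laplacian $L$ of a graph on $[n]=\{1,\dots,n\}$ is the $n\times n$ matrix with $L_{ii}=\deg(i)$, $L_{ij}=-1$ if $\{i,j\}$ is an edge, and $L_{ij}=0$ otherwise. Let $0=\lambda_0<\lambda_1<\cdots<\lambda_k$ be its distinct eigenvalues, with eigenspaces $E_0,\dots,E_k\subset\mathbb{R}^n$ (vectors are viewed as functions $[n]\to\mathbb{R}$). A subset $W\subset[n]$ with weights $a_w\in\mathbb{R}$ ($w\in W$) averages $f:[n]\to\mathbb{R}$ if $\frac1n\sum_{v\in[n]}f(v)=\sum_{w\in W}a_wf(w)$. It is a graphical design of strength $t$ if it averages every $f\in E_0\oplus\cdots\oplus E_t$, and it is uniformly weighted if there is $a>0$ with $a_w=a$ for all $w\in W$; a set $W$ is called a uniformly weighted design of strength $t$ if it is one for some such $a$. Let $\beta=\sum_{i=t+1}^k\dim E_i$ and let $B\in\mathbb{R}^{\beta\times n}$ be a matrix whose rows are the union of chosen bases of $E_{t+1},\dots,E_k$. The $t$-th eigenconfiguration $\mathcal{B}_t=\{b_1,\dots,b_n\}\subset\mathbb{R}^\beta$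 is the multiset of columns of $B$ (the choice of bases is arbitrary). A point configuration in $\mathbb{R}^d$ not contained in an affine hyperplane is $2$-valued if there is a linear functional $a^\top x$ taking exactly two values on its points. *)

theory Defs
  imports "HOL-Library.Multiset" "Jordan_Normal_Form.Spectral_Radius"
    "Jordan_Normal_Form.VS_Connect"
begin

text \<open>
  A graph on \<open>{1..n}\<close> is given by its set \<open>E\<close> of edges, which are two-element sets of vertices.
\<close>

definition simple_graph :: "nat \<Rightarrow> nat set set \<Rightarrow> bool" where
  "simple_graph n E \<longleftrightarrow> E \<subseteq> {{i, j} | i j. i \<in> {1..n} \<and> j \<in> {1..n} \<and> i \<noteq> j}"

definition connected_graph :: "nat \<Rightarrow> nat set set \<Rightarrow> bool" where
  "connected_graph n E \<longleftrightarrow> (\<forall>u\<in>{1..n}. \<forall>v\<in>{1..n}. (u, v) \<in> {(x, y). {x, y} \<in> E}\<^sup>*)"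

text \<open>The vertices \<open>1, \<dots>, n\<close> are listed in the order of construction.\<close>

definition threshold_graph :: "nat \<Rightarrow> nat set set \<Rightarrow> bool" where
  "threshold_graph n E \<longleftrightarrow> simple_graph n E \<and>
     (\<forall>i\<in>{1..n}. (\<forall>j\<in>{1..<i}. {i, j} \<in> E) \<or> (\<forall>j\<in>{1..<i}. {i, j} \<notin> E))"

definition degree_of :: "nat \<Rightarrow> nat set set \<Rightarrow> nat \<Rightarrow> nat" where
  "degree_of n E i = card {j \<in> {1..n}. {i, j} \<in> E}"

text \<open>
  Indices of vectors and matrices start at \<open>0\<close>: vertex \<open>v\<close> has index \<open>v - 1\<close>, and a function
  \<open>f\<close> on \<open>{1..n}\<close> is represented by the vector with entry \<open>f v\<close> at index \<open>v - 1\<close>.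
\<close>

definition laplacian :: "nat \<Rightarrow> nat set set \<Rightarrow> real mat" where
  "laplacian n E = mat n n (\<lambda>(i, j).
     if i = j then real (degree_of n E (i + 1))
     else if {i + 1, j + 1} \<in> E then - 1 else 0)"

abbreviation vertex_val :: "real vec \<Rightarrow> nat \<Rightarrow> real" where
  "vertex_val f v \<equiv> f $ (v - 1)"

text \<open>
  The index \<open>i\<close> is meaningful for
  \<open>i < card (spectrum (laplacian n E))\<close> only.
\<close>

definition lap_eigenvalue :: "nat \<Rightarrow> nat set set \<Rightarrow> nat \<Rightarrow> real" where
  "lap_eigenvalue n E i = sorted_list_of_set (spectrum (laplacian n E)) ! i"

definition eigenspace :: "nat \<Rightarrow> nat set set \<Rightarrow> nat \<Rightarrow> real vec set" where
  "eigenspace n E i =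
     {f \<in> carrier_vec n. laplacian n E *\<^sub>v f = lap_eigenvalue n E i \<cdot>\<^sub>v f}"

definition eigenspace_sum :: "nat \<Rightarrow> nat set set \<Rightarrow> nat \<Rightarrow> real vec set" where
  "eigenspace_sum n E t =
     {finsum_vec TYPE(real) n g {0..t} | g. \<forall>i\<in>{0..t}. g i \<in> eigenspace n E i}"

definition averages :: "nat \<Rightarrow> nat set \<Rightarrow> (nat \<Rightarrow> real) \<Rightarrow> real vec \<Rightarrow> bool" where
  "averages n W a f \<longleftrightarrow>
     1 / real n * (\<Sum>v\<in>{1..n}. vertex_val f v) = (\<Sum>w\<in>W. a w * vertex_val f w)"

definition graphical_design ::
    "nat \<Rightarrow> nat set set \<Rightarrow> nat \<Rightarrow> nat set \<Rightarrow> (nat \<Rightarrow> real) \<Rightarrow> bool" where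
  "graphical_design n E t W a \<longleftrightarrow>
     W \<subseteq> {1..n} \<and> (\<forall>f\<in>eigenspace_sum n E t. averages n W a f)"

definition uniformly_weighted_design :: "nat \<Rightarrow> nat set set \<Rightarrow> nat \<Rightarrow> nat set \<Rightarrow> bool" where
  "uniformly_weighted_design n E t W \<longleftrightarrow>
     (\<exists>a. graphical_design n E t W a \<and> (\<exists>c>0. \<forall>w\<in>W. a w = c))"

abbreviation eigenspace_vs :: "nat \<Rightarrow> nat set set \<Rightarrow> nat \<Rightarrow> (real, real vec) module" where
  "eigenspace_vs n E i \<equiv> (module_vec TYPE(real) n)\<lparr>carrier := eigenspace n E i\<rparr>"

text \<open>The indices \<open>t + 1, \<dots>, k\<close>, where \<open>k + 1\<close> is the number of distinct eigenvalues.\<close>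

abbreviation upper_indices :: "nat \<Rightarrow> nat set set \<Rightarrow> nat \<Rightarrow> nat set" where
  "upper_indices n E t \<equiv> {t<..<card (spectrum (laplacian n E))}"

definition config_dim :: "nat \<Rightarrow> nat set set \<Rightarrow> nat \<Rightarrow> nat" where
  "config_dim n E t =
     (\<Sum>i\<in>upper_indices n E t. vectorspace.dim class_ring (eigenspace_vs n E i))"

text \<open>
  The matrix has as many rows as the bases have elements in total, so every basis vector occurs as
  a row exactly once; the order of the rows is arbitrary.
\<close>

definition eigenbasis_matrix :: "nat \<Rightarrow> nat set set \<Rightarrow> nat \<Rightarrow> real mat \<Rightarrow> bool" where
  "eigenbasis_matrix n E t B \<longleftrightarrow>
     B \<in> carrier_mat (config_dim n E t) n \<and>
     (\<exists>S. (\<forall>i\<in>upper_indices n E t. vectorspace.basis class_ring (eigenspace_vs n E i) (S i)) \<and>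
          set (rows B) = (\<Union>i\<in>upper_indices n E t. S i))"

definition eigenconfiguration ::
    "nat \<Rightarrow> nat set set \<Rightarrow> nat \<Rightarrow> real vec multiset \<Rightarrow> bool" where
  "eigenconfiguration n E t P \<longleftrightarrow> (\<exists>B. eigenbasis_matrix n E t B \<and> P = mset (cols B))"

definition in_affine_hyperplane :: "nat \<Rightarrow> real vec set \<Rightarrow> bool" where
  "in_affine_hyperplane d X \<longleftrightarrow>
     (\<exists>c\<in>carrier_vec d. c \<noteq> 0\<^sub>v d \<and> (\<exists>r. \<forall>x\<in>X. c \<bullet> x = r))"

definition two_valued :: "nat \<Rightarrow> real vec multiset \<Rightarrow> bool" where
  "two_valued d P \<longleftrightarrow>
     set_mset P \<subseteq> carrier_vec d \<and>
     \<not> in_affine_hyperplane d (set_mset P) \<and>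
     (\<exists>a\<in>carrier_vec d. card ((\<lambda>x. a \<bullet> x) ` set_mset P) = 2)"

end

theory Submission
  imports Defs
begin

text \<open>
  Connectedness makes the last vertex dominating, so row \<open>n\<close> of \<open>L f = x f\<close> reads
  \<open>\<Sum>f = (n - x) f(n)\<close>. Eigenvectors with \<open>x \<noteq> 0\<close> sum to zero, so \<open>{n}\<close> averages every
  eigenvector with \<open>x \<noteq> n\<close>; and \<open>n\<close> is the largest eigenvalue, with eigenvector
  \<open>h = n e\<^sub>n - 1\<close>. A linear functional on the eigenconfiguration is a function in the span of
  \<open>E\<^bsub>t+1\<^esub>, \<dots>, E\<^sub>k\<close>, which is orthogonal to the constants; hence no nonzero functional is
  constant, and \<open>h\<close> gives a functional with exactly two values.
\<close>

section \<open>The Laplacian: difference form, symmetry, range of the eigenvalues\<close>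

lemma laplacian_carrier [simp]: "laplacian n E \<in> carrier_mat n n"
  by (simp add: laplacian_def)

lemma simple_graph_edgeD:
  assumes "simple_graph n E" "{i, j} \<in> E"
  shows "i \<noteq> j" "i \<in> {1..n}" "j \<in> {1..n}"
  using assms by (auto simp: simple_graph_def doubleton_eq_iff dest!: subsetD)

lemma laplacian_mult_index_sum:
  assumes "f \<in> carrier_vec n" "i < n"
  shows "(laplacian n E *\<^sub>v f) $ i = (\<Sum>j<n. laplacian n E $$ (i, j) * f $ j)"
  using assms by (simp add: laplacian_def scalar_prod_def atLeast0LessThan)

text \<open>The degree is spread over the edges, one unit for each neighbour. In this form constants
  visibly lie in the kernel, and at a maximum of \<open>f\<close> every term has a known
  sign.\<close>

lemma laplacian_mult_index:
  assumes G: "simple_graph n E" and f: "f \<in> carrier_vec n" and i: "i < n"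
  shows "(laplacian n E *\<^sub>v f) $ i =
    (\<Sum>j<n. if {i + 1, j + 1} \<in> E then f $ i - f $ j else 0)"
proof -
  have loop: "{i + 1, i + 1} \<notin> E" for i
    using simple_graph_edgeD(1)[OF G, of "i + 1" "i + 1"] by blast
  have "{j \<in> {1..n}. {i + 1, j} \<in> E} = Suc ` {j \<in> {..<n}. {i + 1, j + 1} \<in> E}"
    by (auto simp: image_iff) (metis Suc_le_eq Suc_pred One_nat_def less_eq_Suc_le)
  then have "degree_of n E (i + 1) = card {j \<in> {..<n}. {i + 1, j + 1} \<in> E}"
    by (simp add: degree_of_def card_image)
  then have deg: "real (degree_of n E (i + 1)) = (\<Sum>j<n. if {i + 1, j + 1} \<in> E then 1 else 0)"
    by (simp add: sum.If_cases Int_def)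
  have "(laplacian n E *\<^sub>v f) $ i = (\<Sum>j<n. (if j = i then real (degree_of n E (i + 1)) * f $ i else 0)
      - (if {i + 1, j + 1} \<in> E then f $ j else 0))"
    unfolding laplacian_mult_index_sum[OF f i] using i loop
    by (intro sum.cong) (auto simp: laplacian_def)
  also have "\<dots> = real (degree_of n E (i + 1)) * f $ i
      - (\<Sum>j<n. if {i + 1, j + 1} \<in> E then f $ j else 0)"
    using i by (simp add: sum_subtractf)
  also have "\<dots> = (\<Sum>j<n. if {i + 1, j + 1} \<in> E then f $ i - f $ j else 0)"
    unfolding deg sum_distrib_right sum_subtractf[symmetric] by (intro sum.cong) auto
  finally show ?thesis .
qed

lemma laplacian_self_adjoint:
  assumes f: "f \<in> carrier_vec n" and g: "g \<in> carrier_vec n"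
  shows "(\<Sum>i<n. (laplacian n E *\<^sub>v f) $ i * g $ i) = (\<Sum>i<n. f $ i * (laplacian n E *\<^sub>v g) $ i)"
proof -
  have sym: "laplacian n E $$ (i, j) = laplacian n E $$ (j, i)" if "i < n" "j < n" for i j
    using that by (simp add: laplacian_def insert_commute)
  have "(\<Sum>i<n. (laplacian n E *\<^sub>v f) $ i * g $ i)
      = (\<Sum>i<n. \<Sum>j<n. laplacian n E $$ (i, j) * f $ j * g $ i)"
    using f by (simp add: laplacian_mult_index_sum sum_distrib_right del: index_mult_mat_vec)
  also have "\<dots> = (\<Sum>j<n. \<Sum>i<n. laplacian n E $$ (i, j) * f $ j * g $ i)"
    by (rule sum.swap)
  also have "\<dots> = (\<Sum>j<n. \<Sum>i<n. f $ j * (laplacian n E $$ (j, i) * g $ i))"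
    using sym by (intro sum.cong) (auto simp: mult_ac)
  also have "\<dots> = (\<Sum>j<n. f $ j * (laplacian n E *\<^sub>v g) $ j)"
    using g by (simp add: laplacian_mult_index_sum sum_distrib_left del: index_mult_mat_vec)
  finally show ?thesis .
qed

lemma laplacian_eigenvector_orthogonal:
  assumes "f \<in> carrier_vec n" "g \<in> carrier_vec n"
    and "laplacian n E *\<^sub>v f = x \<cdot>\<^sub>v f" "laplacian n E *\<^sub>v g = y \<cdot>\<^sub>v g" "x \<noteq> y"
  shows "(\<Sum>i<n. f $ i * g $ i) = 0"
proof -
  have "x * (\<Sum>i<n. f $ i * g $ i) = y * (\<Sum>i<n. f $ i * g $ i)"
    using laplacian_self_adjoint[OF assms(1,2), of E] assms(1,2)
    by (simp add: assms(3,4) sum_distrib_left mult_ac del: index_mult_mat_vec)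
  then show ?thesis using \<open>x \<noteq> y\<close> by simp
qed

text \<open>The sum is the inner product with the all-ones vector, which is an eigenvector for
  0.\<close>

lemma laplacian_eigenvector_sum_zero:
  assumes G: "simple_graph n E" and f: "f \<in> carrier_vec n"
    and eig: "laplacian n E *\<^sub>v f = x \<cdot>\<^sub>v f" and "x \<noteq> 0"
  shows "(\<Sum>i<n. f $ i) = 0"
proof -
  let ?one = "vec n (\<lambda>_. 1 :: real)"
  have "laplacian n E *\<^sub>v ?one = 0 \<cdot>\<^sub>v ?one"
  proof (rule eq_vecI)
    fix i assume "i < dim_vec (0 \<cdot>\<^sub>v ?one)"
    then show "(laplacian n E *\<^sub>v ?one) $ i = (0 \<cdot>\<^sub>v ?one) $ i"
      by (simp add: laplacian_mult_index[OF G] del: index_mult_mat_vec cong: if_cong)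
  qed (simp add: laplacian_def)
  from laplacian_eigenvector_orthogonal[OF f _ eig this \<open>x \<noteq> 0\<close>] show ?thesis
    by simp
qed

text \<open>At a vertex where an eigenvector is maximal, all terms of the Laplacian are nonnegative, and
  adding the missing non-neighbours turns it into the Laplacian of the complete graph.\<close>

lemma laplacian_eigenvalue_bounds:
  assumes G: "simple_graph n E" and "eigenvalue (laplacian n E) x"
  shows "0 \<le> x" "x \<le> real n"
proof -
  obtain f where f: "f \<in> carrier_vec n" "f \<noteq> 0\<^sub>v n" and eig: "laplacian n E *\<^sub>v f = x \<cdot>\<^sub>v f"
    using assms(2) by (auto simp: eigenvalue_def eigenvector_def laplacian_def)
  have "0 \<le> x \<and> x \<le> real n" if "x \<noteq> 0"
  proof -
    have sum0: "(\<Sum>i<n. f $ i) = 0"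
      by (rule laplacian_eigenvector_sum_zero[OF G f(1) eig that])
    obtain j where j: "j < n" "f $ j \<noteq> 0" using f by (metis eq_vecI carrier_vecD index_zero_vec)
    define M where "M = Max ((\<lambda>i. f $ i) ` {..<n})"
    have "M \<in> (\<lambda>i. f $ i) ` {..<n}"
      unfolding M_def using j by (intro Max_in) auto
    then obtain v where v: "v < n" "f $ v = M" by auto
    have le: "f $ i \<le> f $ v" if "i < n" for i
      unfolding v(2) M_def using that by (intro Max_ge) auto
    \<comment> \<open>If the maximum were not positive, all entries would be nonpositive with sum
      zero, so \<open>f\<close> would vanish.\<close>
    have pos: "f $ v > 0"
    proof (rule ccontr)
      assume "\<not> f $ v > 0"
      then have "\<forall>i\<in>{..<n}. 0 \<le> - f $ i" using le by fastforce
      then have "\<forall>i\<in>{..<n}. - f $ i = 0"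
        using sum0 by (subst sum_nonneg_eq_0_iff[symmetric]) (auto simp: sum_negf)
      then show False using j by auto
    qed
    have eq: "x * f $ v = (\<Sum>j<n. if {v + 1, j + 1} \<in> E then f $ v - f $ j else 0)"
      using laplacian_mult_index[OF G f(1) v(1)] f(1) v(1) by (simp add: eig)
    have "0 \<le> x * f $ v"
      unfolding eq using le by (intro sum_nonneg) auto
    moreover have "x * f $ v \<le> (\<Sum>j<n. f $ v - f $ j)"
      unfolding eq using le by (intro sum_mono) auto
    then have "x * f $ v \<le> real n * f $ v"
      using sum0 by (simp add: sum_subtractf)
    ultimately show ?thesis using pos by (simp add: zero_le_mult_iff)
  qed
  then show "0 \<le> x" "x \<le> real n" by (cases "x = 0"; simp)+
qed

section \<open>The dominating last vertex and its eigenvector\<close>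

text \<open>A walk from \<open>n\<close> to 1 is nonempty because \<open>2 <= n\<close>, so its
  first edge gives \<open>n\<close> a neighbour. That neighbour comes before \<open>n\<close>, hence
  \<open>n\<close> was not added as an isolated vertex.\<close>

lemma threshold_connected_last_dominating:
  assumes T: "threshold_graph n E" and C: "connected_graph n E" and n: "2 \<le> n"
    and j: "j \<in> {1..<n}"
  shows "{n, j} \<in> E"
proof -
  have G: "simple_graph n E" using T by (simp add: threshold_graph_def)
  have "(n, 1) \<in> {(x, y). {x, y} \<in> E}\<^sup>*"
    using C n by (auto simp: connected_graph_def)
  then obtain y where "{n, y} \<in> E"
    using n by (auto elim: converse_rtranclE)
  with simple_graph_edgeD[OF G this] have "y \<in> {1..<n}" "{n, y} \<in> E" by auto
  moreover have "(\<forall>j\<in>{1..<n}. {n, j} \<in> E) \<or> (\<forall>j\<in>{1..<n}. {n, j} \<notin> E)"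
    using T n by (auto simp: threshold_graph_def)
  ultimately show ?thesis using j by blast
qed

lemma dominating_eigenvector_value:
  assumes G: "simple_graph n E" and dom: "\<And>j. j \<in> {1..<n} \<Longrightarrow> {n, j} \<in> E" and n: "1 \<le> n"
    and f: "f \<in> carrier_vec n" and eig: "laplacian n E *\<^sub>v f = x \<cdot>\<^sub>v f"
  shows "(\<Sum>i<n. f $ i) = (real n - x) * f $ (n - 1)"
proof -
  have "x * f $ (n - 1) = (laplacian n E *\<^sub>v f) $ (n - 1)"
    using f n by (simp add: eig)
  also have "\<dots> = (\<Sum>j<n. if {n - 1 + 1, j + 1} \<in> E then f $ (n - 1) - f $ j else 0)"
    using n by (intro laplacian_mult_index[OF G f]) simp
  \<comment> \<open>The only index that fails the edge test is \<open>n - 1\<close> itself, where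
    the difference is zero anyway.\<close>
  also have "\<dots> = (\<Sum>j<n. f $ (n - 1) - f $ j)"
  proof (rule sum.cong[OF refl])
    fix j assume "j \<in> {..<n}"
    then have "j = n - 1 \<or> {n - 1 + 1, j + 1} \<in> E" using dom[of "j + 1"] n by (cases "j = n - 1") auto
    then show "(if {n - 1 + 1, j + 1} \<in> E then f $ (n - 1) - f $ j else 0) = f $ (n - 1) - f $ j"
      by auto
  qed
  finally show ?thesis by (simp add: sum_subtractf algebra_simps)
qed

text \<open>This is \<open>n\<close> times the projection of the unit vector of vertex
  \<open>n\<close> onto the orthogonal complement of the constants.\<close>

definition last_vec :: "nat \<Rightarrow> real vec" where
  "last_vec n = vec n (\<lambda>i. if i = n - 1 then real n - 1 else - 1)"

text \<open>At vertex \<open>n\<close> each of the \<open>n - 1\<close> edges contributes the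
  difference \<open>n\<close>. At any other vertex only the edge to \<open>n\<close> joins different
  values, and it contributes \<open>- n\<close>.\<close>

lemma last_vec_eigenvector:
  assumes G: "simple_graph n E" and dom: "\<And>j. j \<in> {1..<n} \<Longrightarrow> {n, j} \<in> E"
  shows "laplacian n E *\<^sub>v last_vec n = real n \<cdot>\<^sub>v last_vec n"
proof (rule eq_vecI)
  fix i assume "i < dim_vec (real n \<cdot>\<^sub>v last_vec n)"
  then have i: "i < n" by (simp add: last_vec_def)
  let ?h = "last_vec n"
  have h: "?h \<in> carrier_vec n" by (simp add: last_vec_def)
  have "(laplacian n E *\<^sub>v ?h) $ i
      = (\<Sum>j<n. if {i + 1, j + 1} \<in> E then ?h $ i - ?h $ j else 0)"
    by (rule laplacian_mult_index[OF G h i])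
  also have "\<dots> = real n * ?h $ i"
  proof (cases "i = n - 1")
    case True
    have "(\<Sum>j<n. if {i + 1, j + 1} \<in> E then ?h $ i - ?h $ j else 0)
        = (\<Sum>j<n. real n - (if j = n - 1 then real n else 0))"
    proof (rule sum.cong[OF refl])
      fix j assume j: "j \<in> {..<n}"
      then have "j = n - 1 \<or> {i + 1, j + 1} \<in> E" using dom[of "j + 1"] i True by (cases "j = n - 1") auto
      then show "(if {i + 1, j + 1} \<in> E then ?h $ i - ?h $ j else 0)
          = real n - (if j = n - 1 then real n else 0)"
        using True j by (auto simp: last_vec_def)
    qed
    also have "\<dots> = real n * (real n - 1)"
      using i by (simp add: sum_subtractf algebra_simps)
    finally show ?thesis using True i by (simp add: last_vec_def)
  next
    case False
    have "(\<Sum>j<n. if {i + 1, j + 1} \<in> E then ?h $ i - ?h $ j else 0)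
        = (\<Sum>j<n. if j = n - 1 then - real n else 0)"
    proof (rule sum.cong[OF refl])
      fix j assume j: "j \<in> {..<n}"
      have "{i + 1, n - 1 + 1} \<in> E"
        using dom[of "i + 1"] i False by (simp add: insert_commute)
      then show "(if {i + 1, j + 1} \<in> E then ?h $ i - ?h $ j else 0)
          = (if j = n - 1 then - real n else 0)"
        using False i j by (auto simp: last_vec_def)
    qed
    also have "\<dots> = - real n" using i by simp
    finally show ?thesis using False i by (simp add: last_vec_def)
  qed
  also have "\<dots> = (real n \<cdot>\<^sub>v ?h) $ i" using h i by simp
  finally show "(laplacian n E *\<^sub>v ?h) $ i = (real n \<cdot>\<^sub>v ?h) $ i" .
qed (simp add: laplacian_def last_vec_def)

section \<open>The increasing list of distinct eigenvalues\<close>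

lemma lap_eigenvalue_eigenvalue:
  assumes "i < card (spectrum (laplacian n E))"
  shows "eigenvalue (laplacian n E) (lap_eigenvalue n E i)"
proof -
  have "lap_eigenvalue n E i \<in> set (sorted_list_of_set (spectrum (laplacian n E)))"
    unfolding lap_eigenvalue_def using assms by (intro nth_mem) simp
  then show ?thesis
    using card_finite_spectrum(1)[OF laplacian_carrier[of n E]] by (simp add: spectrum_def)
qed

lemma lap_eigenvalue_less:
  assumes "i < j" "j < card (spectrum (laplacian n E))"
  shows "lap_eigenvalue n E i < lap_eigenvalue n E j"
  unfolding lap_eigenvalue_def using assms
  by (intro sorted_wrt_nth_less[of "(<)"]) auto

lemma lap_eigenvalue_surj:
  assumes "eigenvalue (laplacian n E) x"
  obtains i where "i < card (spectrum (laplacian n E))" "lap_eigenvalue n E i = x"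
proof -
  have "x \<in> set (sorted_list_of_set (spectrum (laplacian n E)))"
    using assms card_finite_spectrum(1)[OF laplacian_carrier[of n E]] by (simp add: spectrum_def)
  then show thesis using that by (auto simp: in_set_conv_nth lap_eigenvalue_def)
qed

text \<open>The value \<open>n\<close> occurs in the list and bounds all of it; at an earlier
  position it would be exceeded by the last entry.\<close>

lemma lap_eigenvalue_last:
  assumes G: "simple_graph n E" and dom: "\<And>j. j \<in> {1..<n} \<Longrightarrow> {n, j} \<in> E"
    and n: "2 \<le> n" and card: "card (spectrum (laplacian n E)) = k + 1"
  shows "lap_eigenvalue n E k = real n"
proof -
  have "last_vec n $ (n - 1) \<noteq> 0\<^sub>v n $ (n - 1)" using n by (simp add: last_vec_def)
  then have "last_vec n \<noteq> 0\<^sub>v n" by auto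
  then have "eigenvalue (laplacian n E) (real n)"
    using last_vec_eigenvector[OF G dom]
    by (auto simp: eigenvalue_def eigenvector_def last_vec_def laplacian_def
        intro!: exI[of _ "last_vec n"])
  then obtain i where i: "i < k + 1" "lap_eigenvalue n E i = real n"
    using lap_eigenvalue_surj card by metis
  have "lap_eigenvalue n E k \<le> real n"
    using laplacian_eigenvalue_bounds(2)[OF G lap_eigenvalue_eigenvalue] card by simp
  then show ?thesis
    using i lap_eigenvalue_less[of i k n E] card by (cases "i = k") auto
qed

section \<open>Bases of the eigenspaces\<close>

lemma eigenspace_subset_carrier: "eigenspace n E i \<subseteq> carrier_vec n"
  by (auto simp: eigenspace_def)

context vec_space
begin

text \<open>Carries a basis of the subspace module over to the ambient space, whose
  \<open>span\<close> and \<open>lincomb\<close> then apply.\<close>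

lemma subspace_basis_properties:
  assumes W: "subspace class_ring W V" and S: "vectorspace.basis class_ring (vs W) S"
  shows "S \<subseteq> W" "span S = W" "lin_indpt S"
    and "finite S \<Longrightarrow> vectorspace.dim class_ring (vs W) = card S"
proof -
  have vsW: "vectorspace class_ring (vs W)" by (rule subspace_is_vs[OF W])
  have sub: "submodule class_ring W V" using W by (simp add: subspace_def)
  have b: "module.gen_set class_ring (vs W) S" "\<not> module.lin_dep class_ring (vs W) S" "S \<subseteq> W"
    using S unfolding vectorspace.basis_def[OF vsW] by auto
  show "S \<subseteq> W" by fact
  show "span S = W" using span_li_not_depend(1)[OF b(3) sub] b(1) by simp
  show "lin_indpt S" using span_li_not_depend(2)[OF b(3) sub] b(2) by simp
  show "vectorspace.dim class_ring (vs W) = card S" if "finite S"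
    using vectorspace.dim_basis[OF vsW that S] .
qed

end

lemma mult_mat_vec_zero:
  fixes A :: "'a :: semiring_0 mat"
  assumes "A \<in> carrier_mat m n"
  shows "A *\<^sub>v 0\<^sub>v n = 0\<^sub>v m"
  using assms by (intro eq_vecI) auto

lemma eigenspace_subspace:
  "subspace class_ring (eigenspace n E i) (module_vec TYPE(real) n)"
proof -
  interpret vec_space "TYPE(real)" n .
  show ?thesis
    unfolding subspace_def
  proof (intro conjI vectorspace_axioms)
    show "submodule class_ring (eigenspace n E i) V"
      unfolding submodule_def
      by (auto simp: eigenspace_def module_axioms mult_mat_vec_zero[OF laplacian_carrier] mult_add_distrib_mat_vec[OF laplacian_carrier]
          smult_add_distrib_vec mult_mat_vec[OF laplacian_carrier] smult_smult_assoc mult.commute)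
  qed
qed

text \<open>Restates the basis properties entry by entry, so that later arguments handle finite sums
  of reals instead of \<open>lincomb\<close>.\<close>

lemma eigenspace_basis:
  assumes "vectorspace.basis class_ring (eigenspace_vs n E i) S" and finS: "finite S"
  shows "S \<subseteq> eigenspace n E i"
    and "vectorspace.dim class_ring (eigenspace_vs n E i) = card S"
    and "f \<in> eigenspace n E i \<Longrightarrow> \<exists>a. \<forall>v<n. f $ v = (\<Sum>x\<in>S. a x * x $ v)"
    and "vec n (\<lambda>v. \<Sum>x\<in>S. a x * x $ v) \<in> eigenspace n E i"
    and "\<And>a x. \<lbrakk>\<And>v. v < n \<Longrightarrow> (\<Sum>x\<in>S. a x * x $ v) = 0; x \<in> S\<rbrakk> \<Longrightarrow> a x = 0"
    and "0\<^sub>v n \<notin> S"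
proof -
  interpret vec_space "TYPE(real)" n .
  note b = subspace_basis_properties[OF eigenspace_subspace assms(1)]
  show "S \<subseteq> eigenspace n E i" by (rule b(1))
  then have S: "S \<subseteq> carrier_vec n" using eigenspace_subset_carrier by blast
  show "vectorspace.dim class_ring (eigenspace_vs n E i) = card S" by (rule b(4)[OF finS])
  show "\<exists>a. \<forall>v<n. f $ v = (\<Sum>x\<in>S. a x * x $ v)" if "f \<in> eigenspace n E i"
  proof -
    from that have "f \<in> span S" using b(2) by simp
    from finite_in_span[OF finS _ this] S obtain a where "lincomb a S = f" by auto
    then show ?thesis using lincomb_index[OF _ S, of _ a] by auto
  qed
  have lin: "lincomb a S = vec n (\<lambda>v. \<Sum>x\<in>S. a x * x $ v)" for a
    using S by (intro eq_vecI) (auto simp: lincomb_index lincomb_dim[OF finS S])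
  have "lincomb a S \<in> span S" using finS by (auto simp: span_def)
  then show "vec n (\<lambda>v. \<Sum>x\<in>S. a x * x $ v) \<in> eigenspace n E i"
    unfolding lin b(2) .
  show coeff: "a x = 0" if "\<And>v. v < n \<Longrightarrow> (\<Sum>x\<in>S. a x * x $ v) = 0" "x \<in> S" for a x
  proof -
    have "lincomb a S = 0\<^sub>v n" unfolding lin using that(1) by (intro eq_vecI) auto
    then show ?thesis using b(3) finS that(2) unfolding lin_dep_def by auto
  qed
  show "0\<^sub>v n \<notin> S"
  proof
    assume zero: "0\<^sub>v n \<in> S"
    have "(\<Sum>x\<in>S. (if x = 0\<^sub>v n then 1 else 0) * x $ v) = 0" if "v < n" for v
      using that by (intro sum.neutral) auto
    \<comment> \<open>The combination with coefficient 1 at the zero vector and 0 elsewhere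
      vanishes, so independence would give 1 = 0.\<close>
    from coeff[OF this zero] show False by simp
  qed
qed

section \<open>Independence of eigenspaces and coordinates on the matrix rows\<close>

text \<open>In the inner product of \<open>g i\<close> with the vanishing sum, orthogonality removes
  all terms except the squared norm of \<open>g i\<close>.\<close>

lemma eigenspaces_independent:
  assumes fin: "finite I" and I: "I \<subseteq> {..<card (spectrum (laplacian n E))}"
    and g: "\<And>i. i \<in> I \<Longrightarrow> g i \<in> eigenspace n E i"
    and sum0: "\<And>v. v < n \<Longrightarrow> (\<Sum>i\<in>I. g i $ v) = 0"
    and i: "i \<in> I"
  shows "g i = 0\<^sub>v n"
proof -
  have orth: "(\<Sum>v<n. g i $ v * g j $ v) = 0" if "j \<in> I" "j \<noteq> i" for j
  proof (rule laplacian_eigenvector_orthogonal)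
    show "lap_eigenvalue n E i \<noteq> lap_eigenvalue n E j"
      using lap_eigenvalue_less[of i j n E] lap_eigenvalue_less[of j i n E] that I i
      by (cases i j rule: linorder_cases) auto
  qed (use g[OF i] g[OF that(1)] in \<open>auto simp: eigenspace_def\<close>)
  have "0 = (\<Sum>v<n. g i $ v * (\<Sum>j\<in>I. g j $ v))" using sum0 by simp
  also have "\<dots> = (\<Sum>j\<in>I. \<Sum>v<n. g i $ v * g j $ v)"
    unfolding sum_distrib_left by (rule sum.swap)
  also have "\<dots> = (\<Sum>v<n. g i $ v * g i $ v)"
    using orth fin i by (subst sum.remove[of _ i]) auto
  finally have "\<forall>v\<in>{..<n}. g i $ v * g i $ v = 0"
    by (subst sum_nonneg_eq_0_iff[symmetric]) auto
  then show ?thesis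
    using g[OF i] by (intro eq_vecI) (auto simp: eigenspace_def)
qed

text \<open>Serves to show that bases chosen for different eigenspaces are disjoint.\<close>

lemma eigenspace_index_unique:
  assumes "f \<in> eigenspace n E i" "f \<in> eigenspace n E j" "f \<noteq> 0\<^sub>v n"
    and "i < card (spectrum (laplacian n E))" "j < card (spectrum (laplacian n E))"
  shows "i = j"
proof (rule ccontr)
  assume "i \<noteq> j"
  then have "lap_eigenvalue n E i \<noteq> lap_eigenvalue n E j"
    using lap_eigenvalue_less[of i j n E] lap_eigenvalue_less[of j i n E] assms(4,5)
    by (cases i j rule: linorder_cases) auto
  moreover have "lap_eigenvalue n E i * f $ v = lap_eigenvalue n E j * f $ v" if "v < n" for v
    using assms(1,2) that by (auto simp: eigenspace_def dest!: arg_cong[where f = "\<lambda>u. u $ v"])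
  ultimately have "f = 0\<^sub>v n"
    using assms(1) by (intro eq_vecI) (auto simp: eigenspace_def)
  with assms(3) show False by simp
qed

text \<open>The rows of the matrix are exactly as many as there are basis vectors, hence they are
  pairwise distinct, and coefficient vectors correspond to coefficient functions on the bases.\<close>

lemma eigenbasis_matrix_rows:
  assumes B: "B \<in> carrier_mat (config_dim n E t) n"
    and S: "\<forall>i\<in>upper_indices n E t. vectorspace.basis class_ring (eigenspace_vs n E i) (S i)"
    and rows: "set (rows B) = (\<Union>i\<in>upper_indices n E t. S i)"
  shows "\<And>i. i \<in> upper_indices n E t \<Longrightarrow> finite (S i)"
    and "\<And>i j x. \<lbrakk>i \<in> upper_indices n E t; j \<in> upper_indices n E t; x \<in> S i; x \<in> S j\<rbrakk> \<Longrightarrow> i = j"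
    and "bij_betw (row B) {..<config_dim n E t} (\<Union>i\<in>upper_indices n E t. S i)"
    and "\<And>c a v. \<lbrakk>c \<in> carrier_vec (config_dim n E t); v < n;
        \<And>r. r < config_dim n E t \<Longrightarrow> a (row B r) = c $ r\<rbrakk> \<Longrightarrow>
      c \<bullet> col B v = (\<Sum>i\<in>upper_indices n E t. \<Sum>x\<in>S i. a x * x $ v)"
proof -
  let ?I = "upper_indices n E t" and ?m = "config_dim n E t"
  show fin: "finite (S i)" if "i \<in> ?I" for i
    \<comment> \<open>Each \<open>S i\<close> lies inside the finite set of rows.\<close>
    using that rows by (metis UN_upper finite_set finite_subset)
  note b = eigenspace_basis[OF bspec[OF S] fin]
  \<comment> \<open>A shared basis vector would be nonzero and lie in two eigenspaces.\<close>
  show disj: "i = j" if "i \<in> ?I" "j \<in> ?I" "x \<in> S i" "x \<in> S j" for i j x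
    using eigenspace_index_unique[of x n E i j] b(1)[of i] b(1)[of j] b(6)[of i] that by auto
  have "card (\<Union>i\<in>?I. S i) = (\<Sum>i\<in>?I. card (S i))"
    using fin disj by (intro card_UN_disjoint) blast+
  also have "\<dots> = ?m" unfolding config_dim_def using b(2) by simp
  finally have card: "card (\<Union>i\<in>?I. S i) = ?m" .
  have img: "row B ` {..<?m} = (\<Union>i\<in>?I. S i)"
    using B unfolding rows[symmetric] by (auto simp: rows_def atLeast0LessThan)
  then have inj: "inj_on (row B) {..<?m}" using card by (intro eq_card_imp_inj_on) simp_all
  then show bij: "bij_betw (row B) {..<?m} (\<Union>i\<in>?I. S i)" using img by (simp add: bij_betw_def)
  show "c \<bullet> col B v = (\<Sum>i\<in>?I. \<Sum>x\<in>S i. a x * x $ v)"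
    if c: "c \<in> carrier_vec ?m" and v: "v < n" and a: "\<And>r. r < ?m \<Longrightarrow> a (row B r) = c $ r" for c a v
  proof -
    have "c \<bullet> col B v = (\<Sum>r<?m. a (row B r) * row B r $ v)"
      using B c v a by (auto simp: scalar_prod_def atLeast0LessThan intro!: sum.cong)
    also have "\<dots> = (\<Sum>x\<in>(\<Union>i\<in>?I. S i). a x * x $ v)"
      by (rule sum.reindex_bij_betw[OF bij])
    also have "\<dots> = (\<Sum>i\<in>?I. \<Sum>x\<in>S i. a x * x $ v)"
      using fin disj by (intro sum.UNION_disjoint) blast+
    finally show ?thesis .
  qed
qed

section \<open>Linear functionals on the eigenconfiguration\<close>

text \<open>The eigenvalue at position 0 is nonnegative, so those at later positions are positive
  and their eigenvectors are orthogonal to the constants.\<close>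

lemma eigenspace_sum_zero:
  assumes G: "simple_graph n E" and f: "f \<in> eigenspace n E i"
    and "0 < i" "i < card (spectrum (laplacian n E))"
  shows "(\<Sum>v<n. f $ v) = 0"
proof -
  have "0 \<le> lap_eigenvalue n E 0"
    using laplacian_eigenvalue_bounds(1)[OF G lap_eigenvalue_eigenvalue] assms(4) by force
  also have "\<dots> < lap_eigenvalue n E i" by (rule lap_eigenvalue_less[OF assms(3,4)])
  finally show ?thesis
    using laplacian_eigenvector_sum_zero[OF G, of f] f by (simp add: eigenspace_def)
qed

text \<open>A functional \<open>c\<close> with constant value \<open>r\<close> on the columns writes
  the constant function \<open>r\<close> as a sum of vectors \<open>g i\<close> from the upper
  eigenspaces. Then \<open>r\<close>, each \<open>g i\<close> and finally each entry of
  \<open>c\<close> must be zero.\<close>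

lemma eigenconfiguration_not_in_affine_hyperplane:
  assumes G: "simple_graph n E" and n: "0 < n" and P: "eigenconfiguration n E t P"
  shows "\<not> in_affine_hyperplane (config_dim n E t) (set_mset P)"
proof
  let ?I = "upper_indices n E t" and ?m = "config_dim n E t"
  assume "in_affine_hyperplane ?m (set_mset P)"
  then obtain c r where c: "c \<in> carrier_vec ?m" "c \<noteq> 0\<^sub>v ?m"
    and r: "\<forall>x\<in>set_mset P. c \<bullet> x = r"
    by (auto simp: in_affine_hyperplane_def)
  obtain B where "eigenbasis_matrix n E t B" and PB: "P = mset (cols B)"
    using P by (auto simp: eigenconfiguration_def)
  then obtain S where B: "B \<in> carrier_mat ?m n"
    and S: "\<forall>i\<in>?I. vectorspace.basis class_ring (eigenspace_vs n E i) (S i)"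
    and rows: "set (rows B) = (\<Union>i\<in>?I. S i)"
    unfolding eigenbasis_matrix_def by blast
  note R = eigenbasis_matrix_rows[OF B S rows]
  \<comment> \<open>The entries of \<open>c\<close> are indexed by rows; inverting the bijection
    \<open>row B\<close> turns them into coefficients of basis vectors.\<close>
  define a where "a x = c $ (the_inv_into {..<?m} (row B) x)" for x
  have a: "a (row B q) = c $ q" if "q < ?m" for q
    unfolding a_def using R(3) that by (simp add: the_inv_into_f_f bij_betw_def)
  define g where "g i = vec n (\<lambda>v. \<Sum>x\<in>S i. a x * x $ v)" for i
  have g: "g i \<in> eigenspace n E i" if "i \<in> ?I" for i
    unfolding g_def by (rule eigenspace_basis(4)[OF bspec[OF S that] R(1)[OF that]])
  have gr: "(\<Sum>i\<in>?I. g i $ v) = r" if "v < n" for v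
  proof -
    have "col B v \<in> set_mset P" using B that by (auto simp: PB cols_def)
    then show ?thesis using r R(4)[OF c(1) that a] that by (simp add: g_def)
  qed
  \<comment> \<open>Summing over all vertices tests against the constants, to which the upper
    eigenspaces are orthogonal because their indices exceed \<open>t\<close> and so are
    positive.\<close>
  have "real n * r = (\<Sum>v<n. \<Sum>i\<in>?I. g i $ v)" using gr by simp
  also have "\<dots> = (\<Sum>i\<in>?I. \<Sum>v<n. g i $ v)" by (rule sum.swap)
  also have "\<dots> = 0" using eigenspace_sum_zero[OF G g] by (intro sum.neutral) auto
  finally have "r = 0" using n by simp
  have g0: "g i = 0\<^sub>v n" if "i \<in> ?I" for i
    by (rule eigenspaces_independent[OF _ _ g _ that]) (use gr \<open>r = 0\<close> in auto)
  have a0: "a x = 0" if "i \<in> ?I" "x \<in> S i" for i x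
  proof (rule eigenspace_basis(5)[OF bspec[OF S that(1)] R(1)[OF that(1)] _ that(2)])
    fix v assume "v < n"
    then show "(\<Sum>x\<in>S i. a x * x $ v) = 0"
      using arg_cong[OF g0[OF that(1)], of "\<lambda>u. u $ v"] by (simp add: g_def)
  qed
  have "c $ q = 0" if "q < ?m" for q
  proof -
    have "row B q \<in> (\<Union>i\<in>?I. S i)" using bij_betwE[OF R(3)] that by auto
    then show ?thesis using a0 a[OF that] by auto
  qed
  then show False using c by (metis carrier_vecD eq_vecI index_zero_vec)
qed

text \<open>The coefficients of \<open>f\<close> in the basis \<open>S i\<close>, extended by zero
  to the other bases, are the entries of a functional whose value at column \<open>v\<close> is
  entry \<open>v\<close> of \<open>f\<close>.\<close>

lemma eigenconfiguration_realizes: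
  assumes P: "eigenconfiguration n E t P" and f: "f \<in> eigenspace n E i"
    and i: "i \<in> upper_indices n E t"
  shows "\<exists>c\<in>carrier_vec (config_dim n E t). (\<lambda>x. c \<bullet> x) ` set_mset P = (\<lambda>v. f $ v) ` {..<n}"
proof -
  let ?I = "upper_indices n E t" and ?m = "config_dim n E t"
  obtain B where "eigenbasis_matrix n E t B" and PB: "P = mset (cols B)"
    using P by (auto simp: eigenconfiguration_def)
  then obtain S where B: "B \<in> carrier_mat ?m n"
    and S: "\<forall>i\<in>?I. vectorspace.basis class_ring (eigenspace_vs n E i) (S i)"
    and rows: "set (rows B) = (\<Union>i\<in>?I. S i)"
    unfolding eigenbasis_matrix_def by blast
  note R = eigenbasis_matrix_rows[OF B S rows]
  obtain b where b: "\<forall>v<n. f $ v = (\<Sum>x\<in>S i. b x * x $ v)"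
    using eigenspace_basis(3)[OF bspec[OF S i] R(1)[OF i] f] by blast
  define a where "a x = (if x \<in> S i then b x else 0)" for x
  define c where "c = vec ?m (\<lambda>q. a (row B q))"
  have c: "c \<in> carrier_vec ?m" by (simp add: c_def)
  have val: "c \<bullet> col B v = f $ v" if v: "v < n" for v
  proof -
    have "c \<bullet> col B v = (\<Sum>j\<in>?I. \<Sum>x\<in>S j. a x * x $ v)"
      by (rule R(4)[OF c v]) (simp add: c_def)
    also have "\<dots> = (\<Sum>j\<in>?I. if j = i then \<Sum>x\<in>S i. b x * x $ v else 0)"
    proof (rule sum.cong[OF refl])
      fix j assume j: "j \<in> ?I"
      show "(\<Sum>x\<in>S j. a x * x $ v) = (if j = i then \<Sum>x\<in>S i. b x * x $ v else 0)"
      proof (cases "j = i")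
        case False
        \<comment> \<open>Disjointness of the bases guarantees that no vector of \<open>S j\<close>
          receives a coefficient meant for \<open>S i\<close>.\<close>
        then have "a x = 0" if "x \<in> S j" for x using R(2)[OF j i] that by (auto simp: a_def)
        with False show ?thesis by simp
      qed (simp add: a_def)
    qed
    also have "\<dots> = f $ v" using b v i by simp
    finally show ?thesis .
  qed
  have "set_mset P = col B ` {..<n}" using B by (auto simp: PB cols_def)
  then have "(\<lambda>x. c \<bullet> x) ` set_mset P = (\<lambda>v. f $ v) ` {..<n}"
    using val by (auto simp: image_image intro!: image_cong)
  with c show ?thesis by blast
qed

section \<open>The singleton design and the two values\<close>

text \<open>For eigenvalue 0 this is row \<open>n\<close> of the eigenvector equation. For any other
  eigenvalue the sum is zero, and since the factor \<open>n - x\<close> is nonzero, the same row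
  makes the last entry zero too.\<close>

lemma eigenspace_averages_last:
  assumes G: "simple_graph n E" and dom: "\<And>j. j \<in> {1..<n} \<Longrightarrow> {n, j} \<in> E" and n: "1 \<le> n"
    and f: "f \<in> eigenspace n E i" and "lap_eigenvalue n E i \<noteq> real n"
  shows "(\<Sum>v<n. f $ v) = real n * f $ (n - 1)"
proof -
  from f have fc: "f \<in> carrier_vec n"
    and eig: "laplacian n E *\<^sub>v f = lap_eigenvalue n E i \<cdot>\<^sub>v f"
    by (auto simp: eigenspace_def)
  note val = dominating_eigenvector_value[OF G dom n fc eig]
  show ?thesis
  proof (cases "lap_eigenvalue n E i = 0")
    case False
    from laplacian_eigenvector_sum_zero[OF G fc eig this] assms(5) val show ?thesis by simp
  qed (use val in simp)
qed

theorem theorem4p7: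
  fixes n k :: nat and E :: "nat set set"
  assumes "threshold_graph n E"
    and "connected_graph n E"
    and "card (spectrum (laplacian n E)) = k + 1"
  shows "\<forall>t. 1 \<le> t \<and> t \<le> k - 1 \<longrightarrow>
           uniformly_weighted_design n E t {n} \<and>
           (\<forall>P. eigenconfiguration n E t P \<longrightarrow> two_valued (config_dim n E t) P)"
proof (intro allI impI)
  fix t assume t: "1 \<le> t \<and> t \<le> k - 1"
  have G: "simple_graph n E" using assms(1) by (simp add: threshold_graph_def)
  \<comment> \<open>The bounds on \<open>t\<close> force \<open>k >= 2\<close>, so there are at
    least three distinct eigenvalues, and an \<open>n\<close> by \<open>n\<close> matrix has at most
    \<open>n\<close>.\<close>
  have n: "2 \<le> n"
    using card_finite_spectrum(2)[OF laplacian_carrier[of n E]] assms(3) t by linarith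
  note dom = threshold_connected_last_dominating[OF assms(1,2) n]
  have last: "lap_eigenvalue n E k = real n"
    by (rule lap_eigenvalue_last[OF G dom n assms(3)])
  show "uniformly_weighted_design n E t {n} \<and>
      (\<forall>P. eigenconfiguration n E t P \<longrightarrow> two_valued (config_dim n E t) P)"
  proof (intro conjI allI impI)
    \<comment> \<open>The weight 1 is forced by the constant functions.\<close>
    have "averages n {n} (\<lambda>_. 1) f" if f: "f \<in> eigenspace_sum n E t" for f
    proof -
      obtain g where fg: "f = finsum_vec TYPE(real) n g {0..t}"
        and g: "\<And>i. i \<in> {0..t} \<Longrightarrow> g i \<in> eigenspace n E i"
        using f by (auto simp: eigenspace_sum_def)
      have fi: "f $ v = (\<Sum>i\<in>{0..t}. g i $ v)" if "v < n" for v
        unfolding fg using that g eigenspace_subset_carrier by (intro index_finsum_vec) blast+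
      have "(\<Sum>v<n. f $ v) = (\<Sum>i\<in>{0..t}. \<Sum>v<n. g i $ v)"
        by (simp add: fi sum.swap[of _ "{..<n}"])
      also have "\<dots> = (\<Sum>i\<in>{0..t}. real n * g i $ (n - 1))"
      proof (rule sum.cong[OF refl])
        fix i assume i: "i \<in> {0..t}"
        \<comment> \<open>Since \<open>i <= t < k\<close>, this eigenvalue lies strictly below the
          last one, which is \<open>n\<close>.\<close>
        have "lap_eigenvalue n E i \<noteq> real n"
          using lap_eigenvalue_less[of i k n E] last assms(3) i t by fastforce
        then show "(\<Sum>v<n. g i $ v) = real n * g i $ (n - 1)"
          using n by (intro eigenspace_averages_last[OF G dom _ g[OF i]]) auto
      qed
      also have "\<dots> = real n * f $ (n - 1)" using n by (simp add: fi sum_distrib_left)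
      finally have "(\<Sum>v<n. f $ v) = real n * f $ (n - 1)" .
      moreover have "(\<Sum>v\<in>{1..n}. f $ (v - 1)) = (\<Sum>v<n. f $ v)"
        by (rule sum.reindex_bij_witness[of _ Suc "\<lambda>v. v - 1"]) auto
      ultimately show ?thesis using n by (simp add: averages_def)
    qed
    then show "uniformly_weighted_design n E t {n}"
      using n by (auto simp: uniformly_weighted_design_def graphical_design_def
          intro!: exI[of _ "\<lambda>_. 1"] exI[of _ "1 :: real"])
  next
    fix P assume P: "eigenconfiguration n E t P"
    have "last_vec n \<in> eigenspace n E k"
      using last_vec_eigenvector[OF G dom] by (simp add: eigenspace_def last last_vec_def)
    \<comment> \<open>Here \<open>t < k\<close> is what makes the top eigenspace part of the
      configuration.\<close>
    moreover have "k \<in> upper_indices n E t" using t assms(3) by auto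
    ultimately obtain c where c: "c \<in> carrier_vec (config_dim n E t)"
      "(\<lambda>x. c \<bullet> x) ` set_mset P = (\<lambda>v. last_vec n $ v) ` {..<n}"
      using eigenconfiguration_realizes[OF P] by blast
    \<comment> \<open>As \<open>2 <= n\<close>, the indices 0 and \<open>n - 1\<close> differ, so
      both values are attained.\<close>
    have "(\<lambda>v. last_vec n $ v) ` {..<n} = {real n - 1, - 1}"
    proof
      have "last_vec n $ (n - 1) = real n - 1" "last_vec n $ 0 = - 1"
        using n by (auto simp: last_vec_def)
      then show "{real n - 1, - 1} \<subseteq> (\<lambda>v. last_vec n $ v) ` {..<n}"
        using n image_eqI[of _ "\<lambda>v. last_vec n $ v" "n - 1" "{..<n}"]
          image_eqI[of _ "\<lambda>v. last_vec n $ v" 0 "{..<n}"] by simp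
    qed (auto simp: last_vec_def)
    then have "card ((\<lambda>x. c \<bullet> x) ` set_mset P) = 2" using n c(2) by simp
    moreover have "set_mset P \<subseteq> carrier_vec (config_dim n E t)"
      using P by (auto simp: eigenconfiguration_def eigenbasis_matrix_def cols_def)
    ultimately show "two_valued (config_dim n E t) P"
      using eigenconfiguration_not_in_affine_hyperplane[OF G _ P] n c(1)
      by (auto simp: two_valued_def)
  qed
qed

end
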